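(* Let $N$ be an odd positive integer, written $N = 3^h N_0$ with $h \geq 0$ and $3 \nmid N_0$. For each positive divisor $d$ of $N_0$ let $k_d = \operatorname{ord}_d(3)$ (with $k_1 = 1$), and let $K_N = \sum_{d \mid N_0} \frac{\phi(d)}{k_d}$. Then $\det C_N = 0$ if $k_p$ is even for at least one prime $p \mid N_0$; $\det C_N = 2^{K_N}$ if $k_p$ is odd for all primes $p \mid N_0$ and $N \equiv \pm 1 \pmod 8$; $\det C_N = -2^{K_N}$ if $k_p$ is odd for all primes $p \mid N_0$ and $N \equiv \pm 3 \pmod 8$.
   Context: The Collatz function is $T(n) = n/2$ if $n$ is even and $T(n) = (3n+1)/2$ if $n$ is odd, for nonnegative integers $n$. For an integer $N \geq 1$ the modular Collatz graph $G_N$ has vertex set $\mathbb{Z}_N = \{0,1,\ldots,N-1\}$ and adjacency matrix $C_N = (c_{i,j})_{0 \le i,j \le N-1}$ with $c_{i,j} = \#\{\nu \in \{i, i+N\} : T(\nu) \equiv j \pmod N\}$; in particular $C_1 = (2)$. $\operatorname{ord}_d(3)$ is the multiplicative order of $3$ modulo $d$, with the convention $\operatorname{ord}_1(3) = 1$; $\phi$ is Euler's totient function. *)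

theory Defs
  imports "Jordan_Normal_Form.Determinant" "HOL-Number_Theory.Number_Theory"
begin

definition collatz :: "nat \<Rightarrow> nat" where
  "collatz n = (if even n then n div 2 else (3 * n + 1) div 2)"

definition collatz_mat :: "nat \<Rightarrow> int mat" where
  "collatz_mat N = mat N N (\<lambda>(i, j). int (card {\<nu> \<in> {i, i + N}. [collatz \<nu> = j] (mod N)}))"

(* Intended for N0 > 0 not divisible by 3: then the natural-number division is exact
   by ord_dvd_totient_3 below. The library convention ord 1 3 = 1 gives k_1 = 1. *)
definition K_exponent :: "nat \<Rightarrow> nat" where
  "K_exponent N0 = (\<Sum>d | d dvd N0. totient d div ord d 3)"

lemma ord_dvd_totient_3:
  assumes "\<not> 3 dvd N0" "d dvd N0"
  shows "ord d 3 dvd totient d"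
proof -
  have "coprime (3::nat) N0"
    using assms(1) by (intro prime_imp_coprime) auto
  then have "coprime d 3"
    using assms(2) by (metis coprime_commute coprime_divisors dvd_refl)
  then show ?thesis
    by (rule order_divides_totient)
qed

end

theory Submission
  imports Defs
begin

text \<open>
  For odd \<open>N\<close> the vertices \<open>i\<close> and \<open>i + N\<close> have opposite parity, so row \<open>i\<close> of the matrix has
  entries at \<open>i / 2\<close> and \<open>(3 i + 1) / 2\<close> modulo \<open>N\<close>. Permuting the columns by \<open>j \<mapsto> 2 j\<close> leaves
  \<open>I + A\<close>, where \<open>A\<close> is the matrix of \<open>f x = 3 x + 1\<close>, and costs the sign of multiplication by 2,
  which is determined by \<open>N\<close> modulo 8. Expanding the rows of \<open>I + A\<close> gives the sum of the signs of
  \<open>f\<close> restricted to \<open>U\<close>, over all sets \<open>U\<close> with \<open>f ` U = U\<close>. Since \<open>2 f x + 1 = 3 (2 x + 1)\<close>,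
  \<open>f\<close> is conjugate to multiplication by 3. If all orders are odd, all these signs are 1 and the
  number of such \<open>U\<close> is 2 to the number of cycles of \<open>f\<close>; there are \<open>\<phi>(d) / k\<^sub>d\<close> cycles
  on which \<open>gcd (2 x + 1, N) = N / d\<close>. If the order modulo \<open>p\<close> is even, then
  \<open>x \<mapsto> (-1)\<^sup>t\<close> for \<open>2 x + 1 = 3\<^sup>t\<close> modulo \<open>p\<close>, and \<open>0\<close> if there is no such \<open>t\<close>, is a vector
  in the kernel of \<open>I + A\<close>.
\<close>

section \<open>Determinant of I + A as a signed sum over invariant sets\<close>

lemma sum_of_bool_eq_mult:
  fixes f :: "'a \<Rightarrow> int"
  assumes "finite A"
  shows "(\<Sum>x\<in>A. f x * of_bool (x = a)) = (if a \<in> A then f a else 0)"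
proof -
  have "(\<Sum>x\<in>A. f x * of_bool (x = a)) = (\<Sum>x\<in>A. if x = a then f x else 0)"
    by (intro sum.cong) auto
  then show ?thesis
    using assms by simp
qed

lemma prod_of_bool_eq:
  "finite A \<Longrightarrow> (\<Prod>x\<in>A. of_bool (P x) :: int) = of_bool (\<forall>x\<in>A. P x)"
  by (induction A rule: finite_induct) auto

text \<open>The modified map is the identity off \<open>U\<close>, so if it permutes
  \<open>S\<close>, then \<open>S - U\<close> is its own image and injectivity leaves
  \<open>U\<close> as the image of \<open>U\<close>. Conversely, a map of a finite set onto itself
  is bijective.\<close>

lemma override_permutes_iff:
  assumes "finite S" "U \<subseteq> S"
  shows "override_on id f U permutes S \<longleftrightarrow> f ` U = U"
proof
  assume p: "override_on id f U permutes S"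
  let ?g = "override_on id f U"
  have "inj_on ?g S"
    using p by (rule permutes_inj_on)
  then have "?g ` (S - (S - U)) = ?g ` S - ?g ` (S - U)"
    by (intro inj_on_image_set_diff) auto
  moreover have "?g ` S = S"
    using p by (rule permutes_image)
  moreover have "?g ` (S - U) = S - U"
    by (auto simp: override_on_def)
  moreover have "S - (S - U) = U"
    using assms by auto
  moreover have "?g ` U = f ` U"
    by (auto simp: override_on_def)
  ultimately show "f ` U = U"
    by metis
next
  assume U: "f ` U = U"
  have "finite U"
    using assms finite_subset by blast
  then have "inj_on f U"
    using U by (simp add: finite_surj_inj)
  then have "bij_betw f U U"
    using U by (simp add: bij_betw_def)
  moreover have "override_on id f U x = f x" if "x \<in> U" for x
    using that by simp
  ultimately have "bij_betw (override_on id f U) U U"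
    using bij_betw_cong by metis
  then have "override_on id f U permutes U"
    by (rule bij_imp_permutes) (simp add: override_on_def)
  then show "override_on id f U permutes S"
    using assms(2) by (rule permutes_subset)
qed

text \<open>The two indicators are added, so that a fixed point of \<open>f\<close> gives the
  diagonal entry 2, in agreement with C_1 = (2).\<close>

definition one_plus_fun_mat :: "nat \<Rightarrow> (nat \<Rightarrow> nat) \<Rightarrow> int mat" where
  "one_plus_fun_mat n f = mat n n (\<lambda>(i, j). of_bool (j = f i) + of_bool (j = i))"

text \<open>In the Leibniz formula each product over the rows is expanded, with \<open>U\<close> the
  set of rows where the entry of A is chosen rather than that of I. For given \<open>U\<close> the
  only candidate with a nonzero product is \<open>override_on id f U\<close>, and it counts exactly
  when it is a permutation.\<close>

lemma det_one_plus_fun_mat: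
  "det (one_plus_fun_mat n f) =
    (\<Sum>U | U \<subseteq> {0..<n} \<and> f ` U = U. sign (override_on id f U))"
proof -
  let ?S = "{0..<n}"
  let ?P = "{p. p permutes ?S}"
  have prod_eq: "(\<Prod>i\<in>?S. of_bool (p i = f i) + of_bool (p i = i)) =
      (\<Sum>U\<in>Pow ?S. of_bool (p = override_on id f U) :: int)" if "p \<in> ?P" for p
  proof -
    have out: "p i = i" if "i \<notin> ?S" for i
      using \<open>p \<in> ?P\<close> that by (blast intro: permutes_not_in)
    have "(\<Prod>i\<in>?S. of_bool (p i = f i) + of_bool (p i = i)) =
      (\<Sum>U\<in>Pow ?S. (\<Prod>i\<in>U. of_bool (p i = f i)) * (\<Prod>i\<in>?S - U. of_bool (p i = i)) :: int)"
      by (rule prod_add) simp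
    also have "\<dots> = (\<Sum>U\<in>Pow ?S. of_bool (p = override_on id f U))"
    proof (rule sum.cong)
      fix U assume "U \<in> Pow ?S"
      then have "U \<subseteq> ?S" "finite U"
        using finite_subset by auto
      \<comment> \<open>Outside \<open>?S\<close> both sides are the identity: \<open>p\<close>
        because it permutes \<open>?S\<close>, the other because \<open>U\<close> lies in
        \<open>?S\<close>.\<close>
      have "p = override_on id f U" if "\<forall>i\<in>U. p i = f i" "\<forall>i\<in>?S - U. p i = i"
      proof
        fix i
        show "p i = override_on id f U i"
          using that out[of i] by (cases "i \<in> U"; cases "i \<in> ?S") auto
      qed
      then have "(\<forall>i\<in>U. p i = f i) \<and> (\<forall>i\<in>?S - U. p i = i) \<longleftrightarrow> p = override_on id f U"
        by auto
      then show "(\<Prod>i\<in>U. of_bool (p i = f i)) * (\<Prod>i\<in>?S - U. of_bool (p i = i)) =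
          (of_bool (p = override_on id f U) :: int)"
        using \<open>finite U\<close> by (auto simp: prod_of_bool_eq)
    qed simp
    finally show ?thesis .
  qed
  have less: "p i < n" if "p permutes ?S" "i < n" for p i
    using permutes_in_image[OF that(1), of i] that(2) by simp
  have "det (one_plus_fun_mat n f) =
      (\<Sum>p\<in>?P. sign p * (\<Prod>i\<in>?S. of_bool (p i = f i) + of_bool (p i = i)))"
    unfolding one_plus_fun_mat_def
    by (subst det_def'[of _ n]) (auto intro!: sum.cong prod.cong simp: less)
  also have "\<dots> = (\<Sum>p\<in>?P. \<Sum>U\<in>Pow ?S. sign p * of_bool (p = override_on id f U))"
    by (intro sum.cong refl) (simp only: prod_eq sum_distrib_left)
  also have "\<dots> = (\<Sum>U\<in>Pow ?S. \<Sum>p\<in>?P. sign p * of_bool (p = override_on id f U))"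
    by (rule sum.swap)
  also have "\<dots> = (\<Sum>U\<in>Pow ?S. if f ` U = U then sign (override_on id f U) else 0)"
    by (intro sum.cong refl)
      (auto simp: sum_of_bool_eq_mult finite_permutations override_permutes_iff)
  also have "\<dots> = (\<Sum>U\<in>{U \<in> Pow ?S. f ` U = U}. sign (override_on id f U))"
    by (rule sum.inter_filter[symmetric]) simp
  also have "{U \<in> Pow ?S. f ` U = U} = {U. U \<subseteq> ?S \<and> f ` U = U}"
    by auto
  finally show ?thesis .
qed

section \<open>Signs of permutations with an odd period\<close>

lemma sign_funpow:
  assumes "p permutes S" "finite S"
  shows "sign (p ^^ n) = sign p ^ n"
proof (induction n)
  case 0
  show ?case
    by simp
next
  case (Suc n)
  have "permutation p"
    using assms by (auto simp: permutation_permutes)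
  moreover from this have "permutation (p ^^ n)"
    by (induction n) (auto simp del: comp_apply intro: permutation_compose simp: id_def[symmetric])
  ultimately show ?case
    using Suc by (simp only: funpow.simps sign_compose power_Suc)
qed

text \<open>The sign of \<open>id\<close> is 1, whereas an odd power of -1 is -1.\<close>

lemma sign_eq_1_if_odd_power_id:
  assumes "p permutes S" "finite S" "p ^^ n = id" "odd n"
  shows "sign p = 1"
proof (rule ccontr)
  assume "sign p \<noteq> 1"
  then have "sign p = -1"
    by (cases p rule: sign_cases) auto
  then show False
    using sign_funpow[OF assms(1,2), of n] assms(3,4) by simp
qed

section \<open>The sign of doubling modulo an odd number\<close>

text \<open>The identity from \<open>N\<close> on, as \<open>permutes\<close> demands; this also
  lets the maps for consecutive odd moduli be compared as permutations of all naturals.\<close>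

definition doubling :: "nat \<Rightarrow> nat \<Rightarrow> nat" where
  "doubling N x = (if x < N then 2 * x mod N else x)"

text \<open>A cycle of length \<open>l + 1\<close>. Composed on the right of a sequence, it inserts
  the entry at \<open>a + l\<close> at position \<open>a\<close> and shifts the entries in between
  up by one place.\<close>

definition last_to_pos :: "nat \<Rightarrow> nat \<Rightarrow> nat \<Rightarrow> nat" where
  "last_to_pos a l x = (if x = a then a + l else if a < x \<and> x \<le> a + l then x - 1 else x)"

lemma last_to_pos_Suc:
  "last_to_pos a (Suc l) = transpose (a + l) (a + Suc l) \<circ> last_to_pos a l"
  by (auto simp: fun_eq_iff last_to_pos_def transpose_def)

text \<open>By \<open>last_to_pos_Suc\<close> the cycle is a product of \<open>l\<close>
  transpositions.\<close>

lemma permutation_sign_last_to_pos: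
  "permutation (last_to_pos a l) \<and> sign (last_to_pos a l) = (-1) ^ l"
proof (induction l)
  case 0
  have "last_to_pos a 0 = id"
    by (auto simp: fun_eq_iff last_to_pos_def)
  then show ?case
    by simp
next
  case (Suc l)
  have "permutation (transpose (a + l) (a + Suc l))"
    by (rule permutation_swap_id)
  with Suc show ?case
    unfolding last_to_pos_Suc
    by (intro conjI permutation_compose) (simp_all add: sign_compose sign_swap_id del: comp_apply)
qed

lemma doubling_permutes:
  assumes "odd N"
  shows "doubling N permutes {0..<N}"
proof (rule bij_imp_permutes)
  have "N > 0"
    using assms by (rule odd_pos)
  have "inj_on (doubling N) {0..<N}"
  proof (rule inj_onI)
    fix x y assume "x \<in> {0..<N}" "y \<in> {0..<N}" "doubling N x = doubling N y"
    then have "[2 * x = 2 * y] (mod N)" "x < N" "y < N"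
      by (auto simp: doubling_def cong_def)
    moreover have "coprime 2 N"
      using assms by simp
    ultimately show "x = y"
      by (metis cong_mult_lcancel_nat cong_less_modulus_unique_nat)
  qed
  moreover have "doubling N ` {0..<N} \<subseteq> {0..<N}"
    using \<open>N > 0\<close> by (auto simp: doubling_def)
  ultimately show "bij_betw (doubling N) {0..<N} {0..<N}"
    by (simp add: bij_betw_def endo_inj_surj)
qed (simp add: doubling_def)

text \<open>
  As a sequence of values, doubling modulo \<open>2 m + 1\<close> is \<open>0, 2, ..., 2 m, 1, 3, ..., 2 m - 1\<close>. The step
  to \<open>m + 1\<close> appends \<open>2 m + 1, 2 m + 2\<close> and moves the last value to position \<open>m + 1\<close>.
\<close>

lemma doubling_Suc:
  "doubling (2 * Suc m + 1) = doubling (2 * m + 1) \<circ> last_to_pos (m + 1) (m + 1)"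
proof
  fix x
  \<comment> \<open>For \<open>k < y \<le> 2 * k\<close> the double lies below twice the modulus, so
    a single subtraction reduces it.\<close>
  have dbl: "doubling (2 * k + 1) y =
      (if y \<le> k then 2 * y else if y \<le> 2 * k then 2 * y - (2 * k + 1) else y)" for k y
  proof (cases "y \<le> k")
    case False
    then have "y < 2 * k + 1 \<Longrightarrow> 2 * y mod (2 * k + 1) = 2 * y - (2 * k + 1)"
      by (simp add: le_mod_geq)
    with False show ?thesis
      by (auto simp: doubling_def)
  qed (auto simp: doubling_def)
  show "doubling (2 * Suc m + 1) x = (doubling (2 * m + 1) \<circ> last_to_pos (m + 1) (m + 1)) x"
    unfolding o_def dbl by (auto simp: last_to_pos_def)
qed

text \<open>The step from \<open>m\<close> to \<open>m + 1\<close> contributes (-1)^(m+1), so the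
  sign is (-1)^(m(m+1)/2), which has period 4 in \<open>m\<close>. It is the Jacobi symbol of 2 over
  \<open>2 * m + 1\<close>.\<close>

lemma sign_doubling:
  "sign (doubling (2 * m + 1)) = (if m mod 4 = 0 \<or> m mod 4 = 3 then 1 else -1)"
proof (induction m)
  case 0
  have "doubling 1 = id"
    by (auto simp: fun_eq_iff doubling_def)
  then show ?case
    by simp
next
  case (Suc m)
  have "permutation (doubling (2 * m + 1))"
    using doubling_permutes[of "2 * m + 1"] by (auto simp: permutation_permutes)
  then have "sign (doubling (2 * Suc m + 1)) = sign (doubling (2 * m + 1)) * (-1) ^ (m + 1)"
    unfolding doubling_Suc using permutation_sign_last_to_pos[of "m + 1" "m + 1"]
    by (simp add: sign_compose)
  also have "\<dots> = (if Suc m mod 4 = 0 \<or> Suc m mod 4 = 3 then 1 else -1)"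
  proof -
    have "m mod 4 = 0 \<or> m mod 4 = 1 \<or> m mod 4 = 2 \<or> m mod 4 = 3"
      by linarith
    moreover have "even m \<longleftrightarrow> m mod 4 = 0 \<or> m mod 4 = 2"
      by presburger
    ultimately show ?thesis
      unfolding Suc by (auto simp: mod_Suc)
  qed
  finally show ?case .
qed

section \<open>From the Collatz matrix to I + A\<close>

text \<open>If 3 divides \<open>N\<close>, this map is not injective on the residues; it is a
  permutation only on the subsets that it maps onto themselves.\<close>

definition tripling :: "nat \<Rightarrow> nat \<Rightarrow> nat" where
  "tripling N x = (3 * x + 1) mod N"

text \<open>Doubling both sides of the congruence is reversible modulo odd \<open>N\<close> and
  removes the halving in \<open>collatz\<close>. Of \<open>i\<close> and \<open>i + N\<close>
  exactly one is even; the even one then yields the residue \<open>i\<close>, the odd one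
  \<open>tripling N i\<close>.\<close>

lemma collatz_mat_entry:
  assumes "odd N" "i < N" "j < N"
  shows "collatz_mat N $$ (i, j) =
    of_bool (doubling N j = tripling N i) + of_bool (doubling N j = i)"
proof -
  have cop: "coprime 2 N"
    using assms(1) by simp
  have halve: "[collatz \<nu> = j] (mod N) \<longleftrightarrow> doubling N j = (if even \<nu> then \<nu> else 3 * \<nu> + 1) mod N" for \<nu>
  proof -
    have "[collatz \<nu> = j] (mod N) \<longleftrightarrow> [2 * collatz \<nu> = 2 * j] (mod N)"
      using cop by (simp add: cong_mult_lcancel_nat)
    also have "2 * collatz \<nu> = (if even \<nu> then \<nu> else 3 * \<nu> + 1)"
      by (simp add: collatz_def)
    finally show ?thesis
      using assms by (auto simp: cong_def doubling_def)
  qed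
  have "(3 * (i + N) + 1) mod N = (3 * i + 1 + 3 * N) mod N"
    by (simp add: algebra_simps)
  then have N3: "(3 * (i + N) + 1) mod N = (3 * i + 1) mod N"
    by simp
  let ?P = "\<lambda>\<nu>. [collatz \<nu> = j] (mod N)"
  have "{\<nu> \<in> {i, i + N}. ?P \<nu>} = (if ?P i then {i} else {}) \<union> (if ?P (i + N) then {i + N} else {})"
    by auto
  then have "int (card {\<nu> \<in> {i, i + N}. ?P \<nu>}) = of_bool (?P i) + of_bool (?P (i + N))"
    using assms by auto
  also have "\<dots> = of_bool (doubling N j = tripling N i) + of_bool (doubling N j = i)"
    unfolding halve tripling_def using assms N3 by auto
  finally show ?thesis
    using assms by (simp add: collatz_mat_def)
qed

text \<open>Column \<open>j\<close> of the Collatz matrix is column \<open>doubling N j\<close> of I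
  + A. Transposition turns this into a permutation of rows, the form that
  \<open>det_permute_rows\<close> handles.\<close>

lemma det_collatz_mat:
  assumes "odd N"
  shows "det (collatz_mat N) = sign (doubling N) * det (one_plus_fun_mat N (tripling N))"
proof -
  let ?M = "one_plus_fun_mat N (tripling N)"
  have M: "?M \<in> carrier_mat N N"
    by (simp add: one_plus_fun_mat_def)
  have C: "collatz_mat N \<in> carrier_mat N N"
    by (simp add: collatz_mat_def)
  have less: "doubling N j < N" if "j < N" for j
    using that by (simp add: doubling_def)
  have "transpose_mat (collatz_mat N) = mat N N (\<lambda>(i, j). transpose_mat ?M $$ (doubling N i, j))"
    using less C by (intro eq_matI) (auto simp: one_plus_fun_mat_def collatz_mat_entry[OF assms])
  then have "det (transpose_mat (collatz_mat N)) = sign (doubling N) * det (transpose_mat ?M)"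
    using det_permute_rows[OF transpose_carrier_mat[THEN iffD2, OF M] doubling_permutes[OF assms]]
    by simp
  then show ?thesis
    using det_transpose[OF M] det_transpose[OF C] by simp
qed

section \<open>Conjugation to multiplication by 3\<close>

text \<open>The fixed point of 3x + 1 is -1/2, where 2x + 1 vanishes; in the coordinate 2x + 1 the
  map is therefore linear.\<close>

lemma tripling_cong: "[2 * tripling N x + 1 = 3 * (2 * x + 1)] (mod N)"
proof -
  have "[2 * tripling N x + 1 = 2 * (3 * x + 1) + 1] (mod N)"
    unfolding tripling_def by (intro cong_add cong_mult cong_refl) (simp only: cong_def mod_mod_trivial)
  moreover have "2 * (3 * x + 1) + 1 = 3 * (2 * x + 1)"
    by simp
  ultimately show ?thesis
    by (simp only:)
qed

lemma funpow_tripling_cong: "[2 * (tripling N ^^ n) x + 1 = 3 ^ n * (2 * x + 1)] (mod N)"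
proof (induction n)
  case 0
  show ?case
    by simp
next
  case (Suc n)
  have "[2 * (tripling N ^^ Suc n) x + 1 = 3 * (2 * (tripling N ^^ n) x + 1)] (mod N)"
    using tripling_cong by simp
  also have "[3 * (2 * (tripling N ^^ n) x + 1) = 3 * (3 ^ n * (2 * x + 1))] (mod N)"
    using Suc by (rule cong_scalar_left)
  finally show ?case
    by (simp only: power_Suc mult.assoc)
qed

lemma funpow_tripling_less: "N > 0 \<Longrightarrow> x < N \<Longrightarrow> (tripling N ^^ n) x < N"
  by (induction n) (auto simp: tripling_def)

lemma cong_double_plus_1_iff:
  fixes N x y :: nat
  assumes "odd N" "x < N" "y < N"
  shows "[2 * x + 1 = 2 * y + 1] (mod N) \<longleftrightarrow> x = y"
proof
  assume "[2 * x + 1 = 2 * y + 1] (mod N)"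
  then have "[2 * x = 2 * y] (mod N)"
    by (simp only: cong_add_rcancel_nat)
  moreover have "coprime 2 N"
    using assms(1) by simp
  ultimately show "x = y"
    using assms(2,3) by (metis cong_mult_lcancel_nat cong_less_modulus_unique_nat)
qed simp

section \<open>Even order: a kernel vector\<close>

lemma det_one_plus_tripling_eq_0:
  assumes "odd N" "d dvd N" "coprime d 3" "even (ord d 3)"
  shows "det (one_plus_fun_mat N (tripling N)) = 0"
proof -
  let ?f = "tripling N" and ?k = "ord d 3"
  have "N > 0"
    using assms(1) by (rule odd_pos)
  have "?k > 0"
    using assms(3) by simp
  \<comment> \<open>The parity of the exponent is a Boolean argument, so that one application of
    \<open>?f\<close> negates it and both parities share the proofs of \<open>fwd\<close> and
    \<open>bwd\<close>.\<close>
  define Q where "Q e x \<longleftrightarrow> (\<exists>t. even t = e \<and> [2 * x + 1 = 3 ^ t] (mod d))" for e x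
  define v :: "nat \<Rightarrow> int" where
    "v x = (if Q True x then 1 else if Q False x then -1 else 0)" for x
  have excl: "\<not> (Q True x \<and> Q False x)" for x
  proof
    assume "Q True x \<and> Q False x"
    then obtain s t where "even s" "odd t" "[2 * x + 1 = 3 ^ s] (mod d)" "[2 * x + 1 = 3 ^ t] (mod d)"
      unfolding Q_def by auto
    then have "[3 ^ s = 3 ^ t] (mod d)"
      by (meson cong_sym cong_trans)
    \<comment> \<open>Equal powers have exponents that agree modulo the order and hence modulo 2,
      the order being even.\<close>
    then have "[s = t] (mod ?k)"
      using order_divides_expdiff[OF assms(3)] by blast
    then have "[s = t] (mod 2)"
      using assms(4) by (rule cong_dvd_modulus_nat)
    with \<open>even s\<close> \<open>odd t\<close> show False
      by (auto simp: cong_def)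
  qed
  have step: "[2 * ?f x + 1 = 3 * (2 * x + 1)] (mod d)" for x
    using tripling_cong assms(2) by (rule cong_dvd_modulus_nat)
  have fwd: "Q (\<not> e) (?f x)" if Q: "Q e x" for e x
  proof -
    obtain t where t: "even t = e" "[2 * x + 1 = 3 ^ t] (mod d)"
      using Q unfolding Q_def by (elim exE conjE)
    have "[3 * (2 * x + 1) = 3 * 3 ^ t] (mod d)"
      using t(2) by (rule cong_scalar_left)
    then have "[2 * ?f x + 1 = 3 ^ Suc t] (mod d)"
      unfolding power_Suc using step[of x] by (simp only: cong_def)
    moreover have "even (Suc t) = (\<not> e)"
      using t(1) by simp
    ultimately show ?thesis
      unfolding Q_def by (intro exI conjI)
  qed
  have bwd: "Q (\<not> e) x" if Q: "Q e (?f x)" for e x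
  proof -
    obtain t where t: "even t = e" "[2 * ?f x + 1 = 3 ^ t] (mod d)"
      using Q unfolding Q_def by (elim exE conjE)
    \<comment> \<open>A full period is added before removing one factor 3, so that the exponent
      \<open>t + ?k - 1\<close> makes sense for \<open>t = 0\<close> too. As \<open>?k\<close> is
      even, its parity is opposite to that of \<open>t\<close>.\<close>
    have "[3 ^ ?k = 1] (mod d)"
      using ord_works by blast
    then have "[3 ^ t * 3 ^ ?k = 3 ^ t * 1] (mod d)"
      by (rule cong_scalar_left)
    moreover have "(3::nat) ^ t * 3 ^ ?k = 3 * 3 ^ (t + ?k - 1)"
      using \<open>?k > 0\<close> by (simp flip: power_add power_Suc)
    ultimately have "[3 * 3 ^ (t + ?k - 1) = 3 ^ t] (mod d)"
      by simp
    moreover have "[3 * (2 * x + 1) = 3 ^ t] (mod d)"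
      using step[of x] t(2) by (simp only: cong_def)
    ultimately have "[3 * (2 * x + 1) = 3 * 3 ^ (t + ?k - 1)] (mod d)"
      by (simp only: cong_def)
    then have "[2 * x + 1 = 3 ^ (t + ?k - 1)] (mod d)"
      using assms(3) by (simp only: cong_mult_lcancel_nat coprime_commute)
    moreover have "even (t + ?k - 1) = (\<not> e)"
      using t(1) assms(4) \<open>?k > 0\<close> by (simp del: ord_gt_0_iff)
    ultimately show ?thesis
      unfolding Q_def by (intro exI conjI)
  qed
  have "Q True (?f x) \<longleftrightarrow> Q False x" "Q False (?f x) \<longleftrightarrow> Q True x" for x
    using fwd[of True x] fwd[of False x] bwd[of True x] bwd[of False x]
    unfolding not_True_eq_False not_False_eq_True by blast+
  then have v_step: "v (?f x) + v x = 0" for x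
    using excl[of x] unfolding v_def by (cases "Q True x"; cases "Q False x") simp_all
  have "Q True 0"
    unfolding Q_def by (rule exI[of _ 0]) simp
  then have "v 0 \<noteq> 0"
    by (simp add: v_def)
  let ?M = "one_plus_fun_mat N ?f"
  have M: "?M \<in> carrier_mat N N"
    by (simp add: one_plus_fun_mat_def)
  have "?M *\<^sub>v vec N v = 0\<^sub>v N"
  proof (rule eq_vecI)
    fix i assume "i < dim_vec (0\<^sub>v N :: int vec)"
    then have "i < N"
      by simp
    have "?f i < N"
      using \<open>N > 0\<close> by (simp add: tripling_def)
    have "(?M *\<^sub>v vec N v) $ i = (\<Sum>j\<in>{0..<N}. (of_bool (j = ?f i) + of_bool (j = i)) * v j)"
      using \<open>i < N\<close> by (simp add: one_plus_fun_mat_def scalar_prod_def)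
    also have "\<dots> = (\<Sum>j\<in>{0..<N}. v j * of_bool (j = ?f i)) + (\<Sum>j\<in>{0..<N}. v j * of_bool (j = i))"
      by (simp only: sum.distrib[symmetric] algebra_simps)
    also have "\<dots> = v (?f i) + v i"
      using \<open>i < N\<close> \<open>?f i < N\<close> by (simp only: sum_of_bool_eq_mult finite_atLeastLessThan) simp
    finally show "(?M *\<^sub>v vec N v) $ i = 0\<^sub>v N $ i"
      using v_step \<open>i < N\<close> by simp
  qed (simp add: one_plus_fun_mat_def)
  moreover have "vec N v \<noteq> 0\<^sub>v N"
  proof
    assume "vec N v = 0\<^sub>v N"
    then have "vec N v $ 0 = 0\<^sub>v N $ 0"
      by simp
    then show False
      using \<open>v 0 \<noteq> 0\<close> \<open>N > 0\<close> by simp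
  qed
  ultimately show ?thesis
    unfolding det_0_iff_vec_prod_zero[OF M] by (intro exI[of _ "vec N v"]) simp
qed

section \<open>A common odd exponent\<close>

text \<open>In x^p - 1 = (1 + x + ... + x^(p-1)) (x - 1) the second factor is divisible by
  \<open>n\<close>, and the first is congruent to p, hence to 0, modulo \<open>p\<close>. A factor
  \<open>p\<close> is gained even if \<open>p\<close> already divides \<open>n\<close>.\<close>

lemma cong_1_power_lift:
  fixes x p n :: nat
  assumes "[x = 1] (mod n)" "[x = 1] (mod p)"
  shows "[x ^ p = 1] (mod p * n)"
proof -
  \<comment> \<open>The integers avoid truncation of x - 1 at \<open>x = 0\<close>.\<close>
  have "int n dvd int x - 1" "[int x = 1] (mod int p)"
    using assms by (simp_all add: cong_iff_dvd_diff flip: cong_int_iff)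
  then have "[(\<Sum>i<p. int x ^ i) = (\<Sum>i<p. 1 ^ i)] (mod int p)"
    by (intro cong_sum cong_pow)
  then have "int p dvd (\<Sum>i<p. int x ^ i)"
    by (simp add: cong_def mod_eq_0_iff_dvd)
  then have "int p * int n dvd (\<Sum>i<p. int x ^ i) * (int x - 1)"
    using \<open>int n dvd int x - 1\<close> by (rule mult_dvd_mono)
  also have "(\<Sum>i<p. int x ^ i) * (int x - 1) = int x ^ p - 1"
    by (simp add: power_diff_1_eq mult.commute)
  finally show ?thesis
    by (simp add: cong_iff_dvd_diff flip: cong_int_iff)
qed

text \<open>Induction over the prime factors with multiplicity: if \<open>K\<close> works for
  \<open>n\<close>, then \<open>K * ord p a\<close> works modulo \<open>n\<close> and modulo
  \<open>p\<close>, and a further factor \<open>p\<close>, odd as well, lifts this to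
  \<open>p * n\<close>.\<close>

lemma odd_exponent_exists:
  fixes a n :: nat
  assumes "odd n" "\<And>p. prime p \<Longrightarrow> p dvd n \<Longrightarrow> odd (ord p a)"
  shows "\<exists>K. odd K \<and> [a ^ K = 1] (mod n)"
  using assms
proof (induction n rule: prime_divisors_induct)
  case (factor p n)
  obtain K where K: "odd K" "[a ^ K = 1] (mod n)"
    using factor by auto
  let ?l = "ord p a"
  have "odd ?l" "odd p"
    using factor by auto
  have "[(a ^ K) ^ ?l = 1 ^ ?l] (mod n)"
    using K(2) by (rule cong_pow)
  moreover have "[a ^ ?l = 1] (mod p)"
    using ord_works by blast
  then have "[(a ^ ?l) ^ K = 1 ^ K] (mod p)"
    by (rule cong_pow)
  ultimately have "[a ^ (K * ?l) = 1] (mod n)" "[a ^ (K * ?l) = 1] (mod p)"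
    by (simp_all add: power_mult mult.commute flip: power_mult)
  then have "[(a ^ (K * ?l)) ^ p = 1] (mod p * n)"
    by (rule cong_1_power_lift)
  then have "[a ^ (K * ?l * p) = 1] (mod p * n)"
    by (simp only: power_mult)
  with \<open>odd K\<close> \<open>odd ?l\<close> \<open>odd p\<close> show ?case
    by (metis even_mult_iff)
next
  case (unit n)
  then show ?case
    by (intro exI[of _ 1]) auto
qed simp

section \<open>Orbits and invariant subsets\<close>

text \<open>Forward iterates make sense for a map without inverse; at a periodic point they already
  form the whole cycle.\<close>

definition forward_orbit :: "('a \<Rightarrow> 'a) \<Rightarrow> 'a \<Rightarrow> 'a set" where
  "forward_orbit f x = range (\<lambda>n. (f ^^ n) x)"

lemma self_in_forward_orbit: "x \<in> forward_orbit f x"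
  unfolding forward_orbit_def by (rule range_eqI[of _ _ 0]) simp

lemma funpow_mult_period:
  assumes "(f ^^ K) x = x"
  shows "(f ^^ (K * m)) x = x"
  by (induction m) (simp_all add: assms funpow_add)

text \<open>After \<open>n\<close> steps, \<open>K * n - n\<close> further steps complete a multiple
  of the period and lead back to \<open>x\<close>. Hence orbits of periodic points that share a
  point coincide.\<close>

lemma forward_orbit_eq_if_mem:
  assumes "(f ^^ K) x = x" "K > 0" "y \<in> forward_orbit f x"
  shows "forward_orbit f y = forward_orbit f x"
proof -
  obtain n where y: "y = (f ^^ n) x"
    using assms(3) unfolding forward_orbit_def by auto
  have "(f ^^ m) y = (f ^^ (m + n)) x" for m
    by (simp add: y funpow_add)
  moreover have "(f ^^ m) x = (f ^^ (m + (K * n - n))) y" for m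
  proof -
    have "n \<le> K * n"
      using assms(2) by simp
    then have "m + K * n = m + (K * n - n) + n"
      by linarith
    then have "(f ^^ (m + (K * n - n))) y = (f ^^ (m + K * n)) x"
      unfolding y by (simp only: funpow_add o_apply)
    also have "\<dots> = (f ^^ m) x"
      using funpow_mult_period[OF assms(1)] by (simp add: funpow_add)
    finally show ?thesis
      by simp
  qed
  ultimately show ?thesis
    unfolding forward_orbit_def by (auto simp del: funpow.simps)
qed

lemma image_forward_orbit:
  assumes "(f ^^ K) x = x" "K > 0"
  shows "f ` forward_orbit f x = forward_orbit f x"
proof
  show "f ` forward_orbit f x \<subseteq> forward_orbit f x"
    unfolding forward_orbit_def by (auto intro: range_eqI[of _ _ "Suc _"])
  show "forward_orbit f x \<subseteq> f ` forward_orbit f x"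
  proof
    fix y assume "y \<in> forward_orbit f x"
    then obtain n where "y = (f ^^ n) x"
      unfolding forward_orbit_def by auto
    \<comment> \<open>One more period makes the exponent positive, so that an application of
      \<open>f\<close> can be split off even for \<open>n = 0\<close>.\<close>
    also have "\<dots> = (f ^^ (n + K)) x"
      using assms(1) by (simp add: funpow_add)
    also have "\<dots> = (f ^^ Suc (n + K - 1)) x"
      using assms(2) by simp
    also have "\<dots> = f ((f ^^ (n + K - 1)) x)"
      by (simp only: funpow.simps o_apply)
    finally show "y \<in> f ` forward_orbit f x"
      unfolding forward_orbit_def by blast
  qed
qed

lemma funpow_mem_if_image_eq:
  assumes "f ` U = U" "x \<in> U"
  shows "(f ^^ n) x \<in> U"
  using assms by (induction n) auto

text \<open>Taking unions is a bijection from sets of orbits to invariant subsets: an invariant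
  subset contains the orbit of each of its points, and distinct orbits are disjoint.\<close>

lemma card_invariant_subsets:
  assumes "finite V" "f ` V \<subseteq> V" "K > 0" and per: "\<And>x. x \<in> V \<Longrightarrow> (f ^^ K) x = x"
  shows "card {U. U \<subseteq> V \<and> f ` U = U} = 2 ^ card (forward_orbit f ` V)"
proof -
  let ?O = "forward_orbit f ` V"
  have orbV: "forward_orbit f x \<subseteq> V" if "x \<in> V" for x
  proof -
    have "(f ^^ n) x \<in> V" for n
      using that assms(2) by (induction n) auto
    then show ?thesis
      by (auto simp: forward_orbit_def)
  qed
  have "inj_on Union (Pow ?O)"
  proof (rule inj_onI)
    have sub: "A \<subseteq> B" if A: "A \<subseteq> ?O" and B: "B \<subseteq> ?O" and eq: "\<Union>A = \<Union>B" for A B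
    proof
      fix C assume "C \<in> A"
      then obtain x where x: "x \<in> V" "C = forward_orbit f x"
        using A by auto
      then have "x \<in> \<Union>B"
        using eq \<open>C \<in> A\<close> self_in_forward_orbit by fast
      then obtain y where "y \<in> V" "x \<in> forward_orbit f y" "forward_orbit f y \<in> B"
        using B by blast
      then show "C \<in> B"
        using x forward_orbit_eq_if_mem[OF per assms(3)] by metis
    qed
    fix A B assume "A \<in> Pow ?O" "B \<in> Pow ?O" "\<Union>A = \<Union>B"
    then show "A = B"
      using sub[of A B] sub[of B A] by auto
  qed
  moreover have "Union ` Pow ?O = {U. U \<subseteq> V \<and> f ` U = U}"
  proof
    show "Union ` Pow ?O \<subseteq> {U. U \<subseteq> V \<and> f ` U = U}"
    proof
      fix U assume "U \<in> Union ` Pow ?O"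
      then obtain A where A: "A \<subseteq> ?O" "U = \<Union>A"
        by auto
      have "f ` C = C" if "C \<in> A" for C
        using that A(1) image_forward_orbit[OF per assms(3)] by auto
      then have "f ` U = U"
        unfolding A(2) image_Union by auto
      moreover have "U \<subseteq> V"
        using A orbV by auto
      ultimately show "U \<in> {U. U \<subseteq> V \<and> f ` U = U}"
        by simp
    qed
    show "{U. U \<subseteq> V \<and> f ` U = U} \<subseteq> Union ` Pow ?O"
    proof
      fix U assume "U \<in> {U. U \<subseteq> V \<and> f ` U = U}"
      then have U: "U \<subseteq> V" "f ` U = U"
        by auto
      have "forward_orbit f x \<subseteq> U" if "x \<in> U" for x
        using funpow_mem_if_image_eq[OF U(2) that] by (auto simp: forward_orbit_def)
      then have "U = \<Union>(forward_orbit f ` U)"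
        using self_in_forward_orbit by fast
      then show "U \<in> Union ` Pow ?O"
        using U(1) by blast
    qed
  qed
  ultimately have "card {U. U \<subseteq> V \<and> f ` U = U} = card (Pow ?O)"
    by (metis card_image)
  then show ?thesis
    using assms(1) by (simp add: card_Pow)
qed

lemma card_orbits_of_equal_size:
  assumes "finite V" "K > 0" and per: "\<And>x. x \<in> V \<Longrightarrow> (f ^^ K) x = x"
    and "\<And>x. x \<in> V \<Longrightarrow> forward_orbit f x \<subseteq> V"
    and "\<And>x. x \<in> V \<Longrightarrow> card (forward_orbit f x) = k"
  shows "k * card (forward_orbit f ` V) = card V"
proof -
  let ?O = "forward_orbit f ` V"
  have un: "\<Union>?O = V"
    using assms(4) self_in_forward_orbit by fast
  have "k * card ?O = card (\<Union>?O)"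
  proof (rule card_partition)
    show "finite ?O" "finite (\<Union>?O)"
      using assms(1) un by auto
    show "card c = k" if "c \<in> ?O" for c
      using that assms(5) by auto
    fix c1 c2 assume c: "c1 \<in> ?O" "c2 \<in> ?O" "c1 \<noteq> c2"
    show "c1 \<inter> c2 = {}"
    proof (rule ccontr)
      assume "c1 \<inter> c2 \<noteq> {}"
      then obtain z where "z \<in> c1" "z \<in> c2"
        by auto
      then show False
        using c forward_orbit_eq_if_mem[OF per assms(2)] by (metis imageE)
    qed
  qed
  then show ?thesis
    using un by simp
qed

lemma card_forward_orbit:
  assumes "k > 0" and "\<And>i j. (f ^^ i) x = (f ^^ j) x \<longleftrightarrow> [i = j] (mod k)"
  shows "card (forward_orbit f x) = k"
proof -
  have "(f ^^ n) x = (f ^^ (n mod k)) x" for n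
    using assms(2) by (simp add: cong_def)
  then have "forward_orbit f x = (\<lambda>n. (f ^^ n) x) ` {..<k}"
    unfolding forward_orbit_def using assms(1) by (auto intro: image_eqI[of _ _ "_ mod k"])
  moreover have "inj_on (\<lambda>n. (f ^^ n) x) {..<k}"
    using assms(2) by (auto intro!: inj_onI simp: cong_def)
  ultimately show ?thesis
    by (simp add: card_image)
qed

text \<open>The \<open>K\<close>-th power of the modified map is the identity on \<open>U\<close> by
  periodicity and off \<open>U\<close> by construction, and \<open>K\<close> is odd.\<close>

lemma sign_override_eq_1:
  assumes "finite S" "U \<subseteq> S" "f ` U = U" "odd K" "\<And>x. x \<in> U \<Longrightarrow> (f ^^ K) x = x"
  shows "sign (override_on id f U) = 1"
proof (rule sign_eq_1_if_odd_power_id)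
  show "override_on id f U permutes S"
    using assms(1-3) by (simp add: override_permutes_iff)
  have "(override_on id f U ^^ n) x = (if x \<in> U then (f ^^ n) x else x)" for n x
    using funpow_mem_if_image_eq[OF assms(3)] by (induction n) auto
  then show "override_on id f U ^^ K = id"
    using assms(5) by (auto simp: fun_eq_iff)
qed fact+

section \<open>Cycles of tripling and gcd classes\<close>

text \<open>Once \<open>gcd y N\<close> is divided out of both sides and the modulus, the cofactor
  of \<open>y\<close> is a unit for the remaining modulus and cancels.\<close>

lemma cong_mult_rcancel_gcd:
  fixes a b y N :: nat
  assumes "N > 0"
  shows "[a * y = b * y] (mod N) \<longleftrightarrow> [a = b] (mod N div gcd y N)"
proof -
  define g where "g = gcd y N"
  have "g > 0"
    using assms by (simp add: g_def)
  have y: "y = g * (y div g)" and N: "N = g * (N div g)"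
    by (simp_all add: g_def)
  have "coprime (y div g) (N div g)"
    using assms unfolding g_def by (intro div_gcd_coprime) simp
  have "[a * y = b * y] (mod N) \<longleftrightarrow> [g * (a * (y div g)) = g * (b * (y div g))] (mod g * (N div g))"
    using y N by (simp add: mult.left_commute)
  also have "\<dots> \<longleftrightarrow> [a * (y div g) = b * (y div g)] (mod N div g)"
    using \<open>g > 0\<close> by (simp add: cong_def flip: mult_mod_right)
  also have "\<dots> \<longleftrightarrow> [a = b] (mod N div g)"
    using \<open>coprime (y div g) (N div g)\<close> by (rule cong_mult_rcancel_nat)
  finally show ?thesis
    by (simp add: g_def)
qed

lemma gcd_mult_left_eq:
  fixes a y N :: nat
  assumes "coprime a (N div gcd y N)" "N > 0"
  shows "gcd (a * y) N = gcd y N"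
proof -
  define g where "g = gcd y N"
  have y: "y = g * (y div g)" and N: "N = g * (N div g)"
    by (simp_all add: g_def)
  have "coprime (y div g) (N div g)"
    using assms unfolding g_def by (intro div_gcd_coprime) simp
  then have "coprime (a * (y div g)) (N div g)"
    using assms(1) by (simp add: g_def)
  then have "gcd (g * (a * (y div g))) (g * (N div g)) = g"
    by (simp flip: gcd_mult_distrib_nat)
  moreover have "g * (a * (y div g)) = a * y"
    using y by (simp add: mult.left_commute)
  ultimately have "gcd (a * y) N = g"
    using N by simp
  then show ?thesis
    by (simp only: g_def)
qed

lemma card_gcd_odd_eq_totient:
  fixes N d :: nat
  assumes "odd N" "d dvd N"
  shows "card {x \<in> {0..<N}. gcd (2 * x + 1) N = N div d} = totient d"
proof -
  have "N > 0"
    using assms(1) by (rule odd_pos)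
  obtain m where m: "N = d * m"
    using assms(2) by auto
  \<comment> \<open>Adding 1 after the reduction gives representatives of 2x + 1 that fill
    \<open>{0<..N}\<close>, the range on which \<open>card_gcd_eq_totient\<close> counts.\<close>
  let ?b = "\<lambda>x. doubling N x + 1"
  have gcd_b: "gcd (?b x) N = gcd (2 * x + 1) N" if "x < N" for x
  proof (rule cong_gcd_eq)
    show "[?b x = 2 * x + 1] (mod N)"
      using that by (auto simp: doubling_def cong_def mod_simps)
  qed
  have im: "doubling N ` {0..<N} = {0..<N}" and inj: "inj_on (doubling N) {0..<N}"
    using doubling_permutes[OF assms(1)] by (auto simp: permutes_image permutes_inj_on)
  have "{k \<in> {0<..N}. gcd k N = N div d} = ?b ` {x \<in> {0..<N}. gcd (2 * x + 1) N = N div d}"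
  proof (intro equalityI subsetI)
    fix k assume k: "k \<in> {k \<in> {0<..N}. gcd k N = N div d}"
    then have "k - 1 \<in> doubling N ` {0..<N}"
      unfolding im by auto
    then obtain x where "x < N" "k - 1 = doubling N x"
      by auto
    with k have "k = ?b x"
      by auto
    with k \<open>x < N\<close> show "k \<in> ?b ` {x \<in> {0..<N}. gcd (2 * x + 1) N = N div d}"
      using gcd_b[of x] by auto
  next
    fix k assume "k \<in> ?b ` {x \<in> {0..<N}. gcd (2 * x + 1) N = N div d}"
    then obtain x where x: "x < N" "gcd (2 * x + 1) N = N div d" "k = ?b x"
      by auto
    then have "doubling N x < N"
      using im by auto
    with x show "k \<in> {k \<in> {0<..N}. gcd k N = N div d}"
      using gcd_b[of x] by auto
  qed
  moreover have "inj_on ?b {x \<in> {0..<N}. gcd (2 * x + 1) N = N div d}"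
    using inj by (auto simp: inj_on_def)
  ultimately have "card {x \<in> {0..<N}. gcd (2 * x + 1) N = N div d} = card {k \<in> {0<..N}. gcd k N = N div d}"
    by (simp only: card_image)
  also have "\<dots> = totient (N div (N div d))"
    using \<open>N > 0\<close> m by (intro card_gcd_eq_totient) auto
  also have "N div (N div d) = d"
    using \<open>N > 0\<close> m by auto
  finally show ?thesis .
qed

text \<open>The \<open>n\<close>-th iterate multiplies 2x + 1 by 3^n; cancelling 2x + 1 leaves
  powers of 3 modulo d = N / gcd(2x + 1, N). So \<open>x\<close> lies on a cycle of length
  \<open>ord d 3\<close>.\<close>

lemma funpow_tripling_eq_iff:
  assumes "odd N" "x < N" "coprime (N div gcd (2 * x + 1) N) 3"
  shows "(tripling N ^^ i) x = (tripling N ^^ j) x \<longleftrightarrow>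
    [i = j] (mod ord (N div gcd (2 * x + 1) N) 3)"
proof -
  let ?f = "tripling N"
  have "N > 0"
    using assms(1) by (rule odd_pos)
  have "(?f ^^ i) x = (?f ^^ j) x \<longleftrightarrow> [2 * (?f ^^ i) x + 1 = 2 * (?f ^^ j) x + 1] (mod N)"
    using cong_double_plus_1_iff[OF assms(1)] funpow_tripling_less[OF \<open>N > 0\<close> assms(2)] by blast
  also have "\<dots> \<longleftrightarrow> [3 ^ i * (2 * x + 1) = 3 ^ j * (2 * x + 1)] (mod N)"
    using funpow_tripling_cong[of i N x] funpow_tripling_cong[of j N x] by (simp only: cong_def)
  also have "\<dots> \<longleftrightarrow> [3 ^ i = 3 ^ j] (mod N div gcd (2 * x + 1) N)"
    by (rule cong_mult_rcancel_gcd[OF \<open>N > 0\<close>])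
  also have "\<dots> \<longleftrightarrow> [i = j] (mod ord (N div gcd (2 * x + 1) N) 3)"
    by (rule order_divides_expdiff[OF assms(3)])
  finally show ?thesis .
qed

lemma gcd_funpow_tripling:
  assumes "N > 0" "coprime (N div gcd (2 * x + 1) N) 3"
  shows "gcd (2 * (tripling N ^^ n) x + 1) N = gcd (2 * x + 1) N"
proof -
  have "gcd (2 * (tripling N ^^ n) x + 1) N = gcd (3 ^ n * (2 * x + 1)) N"
    by (intro cong_gcd_eq funpow_tripling_cong)
  also have "\<dots> = gcd (2 * x + 1) N"
    using assms by (intro gcd_mult_left_eq) (simp_all add: coprime_commute)
  finally show ?thesis .
qed

section \<open>Odd orders: counting the invariant sets\<close>

lemma det_one_plus_tripling:
  fixes N N0 h :: nat
  assumes "odd N" "N = 3 ^ h * N0" "\<not> 3 dvd N0"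
    and odd_ord: "\<And>p. prime p \<Longrightarrow> p dvd N0 \<Longrightarrow> odd (ord p 3)"
  shows "det (one_plus_fun_mat N (tripling N)) = 2 ^ K_exponent N0"
proof -
  let ?f = "tripling N" and ?S = "{0..<N}" and ?D = "{d. d dvd N0}"
  have "N > 0"
    using assms(1) by (rule odd_pos)
  then have "N0 > 0"
    using assms(2) by (cases N0) auto
  then have "finite ?D"
    by simp
  have "odd N0"
    using assms(1,2) by simp
  \<comment> \<open>One odd exponent for \<open>N0\<close> is a period of \<open>?f\<close> on every
    class \<open>W d\<close> below, since d divides \<open>N0\<close>.\<close>
  then obtain K where K: "odd K" "[3 ^ K = 1] (mod N0)"
    using odd_exponent_exists[of N0 3] odd_ord by auto
  have "K > 0"
    using K(1) by (rule odd_pos)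
  have cop: "coprime d 3" if "d dvd N0" for d
  proof -
    have "coprime 3 N0"
      using assms(3) by (intro prime_imp_coprime) auto
    then show ?thesis
      using that by (metis coprime_commute coprime_divisors dvd_refl)
  qed
  have dvdN: "d dvd N" if "d dvd N0" for d
    using that assms(2) by simp
  \<comment> \<open>On \<open>W d\<close> the modulus left after cancelling 2x + 1 is N / (N / d) =
    d, so all cycles there have length \<open>ord d 3\<close>.\<close>
  define W where "W d = {x \<in> ?S. gcd (2 * x + 1) N = N div d}" for d
  define V where "V = (\<Union>d\<in>?D. W d)"
  have W: "x < N" "N div gcd (2 * x + 1) N = d" if "x \<in> W d" "d dvd N0" for x d
    using that dvdN[OF that(2)] \<open>N > 0\<close> by (auto simp: W_def elim!: dvdE)
  have disj: "W d \<inter> W d' = {}" if "d dvd N0" "d' dvd N0" "d \<noteq> d'" for d d'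
    using W(2) that by blast
  have orbW: "forward_orbit ?f x \<subseteq> W d" if "x \<in> W d" "d dvd N0" for x d
  proof -
    have "gcd (2 * (?f ^^ n) x + 1) N = N div d" for n
      using gcd_funpow_tripling[OF \<open>N > 0\<close>, of x n] W(2)[OF that] cop[OF that(2)] that(1)
      by (simp add: W_def)
    moreover have "(?f ^^ n) x < N" for n
      using funpow_tripling_less[OF \<open>N > 0\<close> W(1)[OF that]] .
    ultimately show ?thesis
      unfolding forward_orbit_def W_def by auto
  qed
  have iff: "(?f ^^ i) x = (?f ^^ j) x \<longleftrightarrow> [i = j] (mod ord d 3)" if "x \<in> W d" "d dvd N0" for x d i j
    using funpow_tripling_eq_iff[OF assms(1) W(1)[OF that], of i j] W(2)[OF that] cop[OF that(2)]
    by simp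
  have perW: "(?f ^^ K) x = x" if "x \<in> W d" "d dvd N0" for x d
  proof -
    have "[3 ^ K = 1] (mod d)"
      using K(2) that(2) by (rule cong_dvd_modulus_nat)
    then have "[K = 0] (mod ord d 3)"
      by (simp only: ord_divides cong_0_iff)
    then show ?thesis
      using iff[OF that, of K 0] by simp
  qed
  then have perV: "(?f ^^ K) x = x" if "x \<in> V" for x
    using that by (auto simp: V_def)
  have "finite (W d)" for d
    by (simp add: W_def)
  have "V \<subseteq> ?S"
    by (auto simp: V_def W_def)
  then have "finite V"
    using finite_subset by blast
  have fV: "?f ` V \<subseteq> V"
  proof
    fix y assume "y \<in> ?f ` V"
    then obtain x d where "x \<in> W d" "d dvd N0" "y = ?f x"
      by (auto simp: V_def)
    moreover have "?f x \<in> forward_orbit ?f x"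
      unfolding forward_orbit_def by (rule range_eqI[of _ _ 1]) simp
    ultimately show "y \<in> V"
      using orbW by (auto simp: V_def)
  qed
  \<comment> \<open>An invariant set consists of \<open>h\<close>-fold images, for which 3^h divides
    2x + 1. This confines it to \<open>V\<close>, where \<open>?f\<close> is periodic.\<close>
  have inV: "U \<subseteq> V" if "U \<subseteq> ?S" "?f ` U = U" for U
  proof
    fix x assume "x \<in> U"
    have "(?f ^^ n) ` U = U" for n
      by (induction n) (simp_all only: funpow.simps image_comp[symmetric] that(2) image_ident id_def)
    then obtain z where "x = (?f ^^ h) z"
      using \<open>x \<in> U\<close> by blast
    then have "[2 * x + 1 = 3 ^ h * (2 * z + 1)] (mod N)"
      using funpow_tripling_cong by blast
    then have "[2 * x + 1 = 3 ^ h * (2 * z + 1)] (mod 3 ^ h)"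
      using assms(2) cong_dvd_modulus_nat by (metis dvd_triv_left)
    then have "3 ^ h dvd 2 * x + 1"
      by (simp only: cong_dvd_iff dvd_triv_left)
    then have "3 ^ h dvd gcd (2 * x + 1) N"
      using assms(2) by simp
    then obtain g where g: "gcd (2 * x + 1) N = 3 ^ h * g"
      by (rule dvdE)
    \<comment> \<open>The cofactor \<open>e\<close> is the index of the class of \<open>x\<close>:
      since 3^h is absorbed by the gcd, \<open>e\<close> divides \<open>N0\<close>.\<close>
    obtain e where e: "N = gcd (2 * x + 1) N * e"
      by (metis dvdE gcd_dvd2)
    then have "N0 = g * e"
      using g assms(2) by simp
    moreover have "N div e = gcd (2 * x + 1) N"
      using e \<open>N > 0\<close> by (metis nonzero_mult_div_cancel_right mult_0_right less_irrefl)
    ultimately show "x \<in> V"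
      using \<open>x \<in> U\<close> that(1) by (auto simp: V_def W_def intro!: exI[of _ e])
  qed
  have card_orbits: "card (forward_orbit ?f ` W d) = totient d div ord d 3" if "d dvd N0" for d
  proof -
    have "ord d 3 > 0"
      using cop[OF that] by simp
    then have "ord d 3 * card (forward_orbit ?f ` W d) = card (W d)"
      using \<open>finite (W d)\<close> \<open>K > 0\<close> perW orbW iff that
      by (intro card_orbits_of_equal_size card_forward_orbit) blast+
    also have "\<dots> = totient d"
      unfolding W_def using assms(1) dvdN[OF that] by (rule card_gcd_odd_eq_totient)
    finally show ?thesis
      using \<open>ord d 3 > 0\<close> by (metis nonzero_mult_div_cancel_left less_irrefl)
  qed
  have "card (forward_orbit ?f ` V) = card (\<Union>d\<in>?D. forward_orbit ?f ` W d)"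
    by (simp add: V_def image_UN)
  \<comment> \<open>Each orbit stays within one class, so the classes can be counted
    separately.\<close>
  also have "\<dots> = (\<Sum>d\<in>?D. card (forward_orbit ?f ` W d))"
  proof (rule card_UN_disjoint)
    show "\<forall>d\<in>?D. \<forall>d'\<in>?D. d \<noteq> d' \<longrightarrow> forward_orbit ?f ` W d \<inter> forward_orbit ?f ` W d' = {}"
    proof (intro ballI impI)
      fix d d' assume d: "d \<in> ?D" "d' \<in> ?D" "d \<noteq> d'"
      have False if xy: "x \<in> W d" "y \<in> W d'" "forward_orbit ?f x = forward_orbit ?f y" for x y
      proof -
        have "x \<in> W d'"
          using xy d orbW[of y d'] self_in_forward_orbit[of x ?f] by auto
        then show False
          using xy(1) d disj by blast
      qed
      then show "forward_orbit ?f ` W d \<inter> forward_orbit ?f ` W d' = {}"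
        by blast
    qed
  qed (use \<open>finite ?D\<close> \<open>\<And>d. finite (W d)\<close> in auto)
  also have "\<dots> = K_exponent N0"
    unfolding K_exponent_def using card_orbits by (intro sum.cong) auto
  finally have orbits: "card (forward_orbit ?f ` V) = K_exponent N0" .
  have "sign (override_on id ?f U) = 1" if "U \<subseteq> ?S" "?f ` U = U" for U
    using sign_override_eq_1[OF _ that K(1)] inV[OF that] perV by blast
  then have "det (one_plus_fun_mat N ?f) = int (card {U. U \<subseteq> ?S \<and> ?f ` U = U})"
    unfolding det_one_plus_fun_mat by simp
  also have "{U. U \<subseteq> ?S \<and> ?f ` U = U} = {U. U \<subseteq> V \<and> ?f ` U = U}"
    using inV \<open>V \<subseteq> ?S\<close> by blast
  also have "card \<dots> = 2 ^ K_exponent N0"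
    using card_invariant_subsets[OF \<open>finite V\<close> fV \<open>K > 0\<close> perV] orbits by simp
  finally show ?thesis
    by simp
qed

section \<open>The sign in terms of N modulo 8, and the three cases\<close>

text \<open>With \<open>N = 2 * m + 1\<close>, the residues 1 and -1 modulo 8 correspond to
  \<open>m\<close> being 0 or 3 modulo 4, and 3 and -3 to the other two.\<close>

lemma sign_doubling_mod_8:
  assumes "odd N"
  shows "[int N = 1] (mod 8) \<or> [int N = -1] (mod 8) \<Longrightarrow> sign (doubling N) = 1"
    and "[int N = 3] (mod 8) \<or> [int N = -3] (mod 8) \<Longrightarrow> sign (doubling N) = -1"
proof -
  obtain m where m: "N = 2 * m + 1"
    using assms by (rule oddE)
  show "sign (doubling N) = 1" if "[int N = 1] (mod 8) \<or> [int N = -1] (mod 8)"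
  proof -
    have "m mod 4 = 0 \<or> m mod 4 = 3"
      using that unfolding m cong_def by simp presburger
    then show ?thesis
      unfolding m sign_doubling by simp
  qed
  show "sign (doubling N) = -1" if "[int N = 3] (mod 8) \<or> [int N = -3] (mod 8)"
  proof -
    have "\<not> (m mod 4 = 0 \<or> m mod 4 = 3)"
      using that unfolding m cong_def by simp presburger
    then show ?thesis
      unfolding m sign_doubling by simp
  qed
qed

theorem theorem2p12:
  fixes N N0 h :: nat
  assumes "odd N" and "N = 3 ^ h * N0" and "\<not> 3 dvd N0"
  shows "((\<exists>p. prime p \<and> p dvd N0 \<and> even (ord p 3)) \<longrightarrow> det (collatz_mat N) = 0) \<and>
    ((\<forall>p. prime p \<and> p dvd N0 \<longrightarrow> odd (ord p 3)) \<and>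
         ([int N = 1] (mod 8) \<or> [int N = -1] (mod 8)) \<longrightarrow>
       det (collatz_mat N) = 2 ^ K_exponent N0) \<and>
    ((\<forall>p. prime p \<and> p dvd N0 \<longrightarrow> odd (ord p 3)) \<and>
         ([int N = 3] (mod 8) \<or> [int N = -3] (mod 8)) \<longrightarrow>
       det (collatz_mat N) = - (2 ^ K_exponent N0))"
proof (intro conjI impI)
  assume "\<exists>p. prime p \<and> p dvd N0 \<and> even (ord p 3)"
  then obtain p where p: "prime p" "p dvd N0" "even (ord p 3)"
    by blast
  \<comment> \<open>Otherwise the prime \<open>p\<close> would be 3, which does not divide
    \<open>N0\<close>.\<close>
  have "\<not> p dvd 3"
    using p(1,2) assms(3) primes_dvd_imp_eq[of p 3] by auto
  then have "coprime p 3"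
    using p(1) by (simp add: prime_imp_coprime)
  then have "det (one_plus_fun_mat N (tripling N)) = 0"
    using assms p by (intro det_one_plus_tripling_eq_0[of N p]) auto
  then show "det (collatz_mat N) = 0"
    by (simp add: det_collatz_mat[OF assms(1)])
next
  assume "(\<forall>p. prime p \<and> p dvd N0 \<longrightarrow> odd (ord p 3)) \<and>
    ([int N = 1] (mod 8) \<or> [int N = -1] (mod 8))"
  then show "det (collatz_mat N) = 2 ^ K_exponent N0"
    using det_one_plus_tripling[OF assms] sign_doubling_mod_8(1)[OF assms(1)]
    by (simp add: det_collatz_mat[OF assms(1)])
next
  assume "(\<forall>p. prime p \<and> p dvd N0 \<longrightarrow> odd (ord p 3)) \<and>
    ([int N = 3] (mod 8) \<or> [int N = -3] (mod 8))"
  then show "det (collatz_mat N) = - (2 ^ K_exponent N0)"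
    using det_one_plus_tripling[OF assms] sign_doubling_mod_8(2)[OF assms(1)]
    by (simp add: det_collatz_mat[OF assms(1)])
qed

end
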